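(* Let $T^+(b,c)=[T_{n,k}(b,c)]_{n,k\ge 0}$, where $T_{n,k}(b,c)$ is the coefficient of $x^k$ in the Laurent polynomial $\left(x+b+\frac{c}{x}\right)^n$, and let $T_n(b,c)=T_{n,0}(b,c)$ be the generalized central trinomial coefficients. (i) For $b,c\ge 0$, the triangle $T^+(b,c)$ is the recursive matrix corresponding to $\beta=(b,b,b,\ldots)$ and $\gamma=(2c,c,c,\ldots)$, and the numbers $T_n(b,c)$ are the associated Catalan-like numbers. (ii) For real $b,c$, the triangle $T^+(b,c)$ is a Riordan array, and $T^+(b,c)=\mathcal{R}(\mathscr{T}(b,c;x),\mathscr{M}(b,c;x))$, where $\mathscr{T}(b,c;x)=\sum_{n\ge 0}T_n(b,c)x^n$ and $\mathscr{M}(b,c;x)=\sum_{n\ge 0}M_n(b,c)x^n$.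
   Context: Recursive matrix: given sequences $\beta=(b_k)_{k\ge 0}$ and $\gamma=(c_k)_{k\ge 1}$ of nonnegative numbers, the recursive matrix corresponding to $(\beta,\gamma)$ is the infinite lower triangular matrix $[r_{n,k}]_{n,k\ge 0}$ defined by $r_{0,0}=1$ and $r_{n+1,k}=r_{n,k-1}+b_kr_{n,k}+c_{k+1}r_{n,k+1}$, where $r_{n,k}=0$ unless $n\ge k\ge 0$; the entries $r_{n,0}$ of its leftmost column are the associated Catalan-like numbers. Riordan array: for formal power series $g(x),f(x)$, $\mathcal{R}(g(x),f(x))$ is the infinite matrix whose $k$th column ($k\ge 0$) has generating function $x^kf(x)^kg(x)$. The generalized Motzkin numbers are $M_n(b,c)=\sum_{k=0}^{\lfloor n/2\rfloor}\frac{n!}{k!\,(k+1)!\,(n-2k)!}b^{n-2k}c^k$, with generating function $\mathscr{M}(b,c;x)=\frac{1-bx-\sqrt{1-2bx+(b^2-4c)x^2}}{2cx^2}$ (for $c\ne 0$). Also $T_n(b,c)=\sum_{k=0}^{\lfloor n/2\rfloor}\frac{n!}{k!\,k!\,(n-2k)!}b^{n-2k}c^k$ and $\mathscr{T}(b,c;x)=\frac{1}{\sqrt{1-2bx+(b^2-4c)x^2}}$. Convention: $0^0=1$. *)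

theory Defs
  imports Complex_Main "HOL-Computational_Algebra.Computational_Algebra"
begin

text \<open>
  The sequence \<open>\<gamma>\<close> is indexed from 1, so its entry at index 0 is never used.  In the recurrence the
  entry in column \<open>-1\<close> is 0.
\<close>

definition is_recursive_matrix ::
    "(nat \<Rightarrow> real) \<Rightarrow> (nat \<Rightarrow> real) \<Rightarrow> (nat \<Rightarrow> nat \<Rightarrow> real) \<Rightarrow> bool" where
  "is_recursive_matrix \<beta> \<gamma> r \<longleftrightarrow>
     (\<forall>k. 0 \<le> \<beta> k) \<and> (\<forall>k\<ge>1. 0 \<le> \<gamma> k) \<and>
     r 0 0 = 1 \<and>
     (\<forall>n k. n < k \<longrightarrow> r n k = 0) \<and>
     (\<forall>n k. r (Suc n) k =
        (if k = 0 then 0 else r n (k - 1)) + \<beta> k * r n k + \<gamma> (k + 1) * r n (k + 1))"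

lemma is_recursive_matrix_unique:
  assumes "is_recursive_matrix \<beta> \<gamma> r" and "is_recursive_matrix \<beta> \<gamma> s"
  shows "r = s"
proof -
  have "r n k = s n k" for n k
  proof (induction n arbitrary: k)
    case 0
    show ?case using assms by (cases k) (auto simp: is_recursive_matrix_def)
  next
    case (Suc n)
    then show ?case using assms by (simp add: is_recursive_matrix_def)
  qed
  then show ?thesis by blast
qed

definition is_catalan_like ::
    "(nat \<Rightarrow> real) \<Rightarrow> (nat \<Rightarrow> real) \<Rightarrow> (nat \<Rightarrow> real) \<Rightarrow> bool" where
  "is_catalan_like \<beta> \<gamma> a \<longleftrightarrow> (\<exists>r. is_recursive_matrix \<beta> \<gamma> r \<and> (\<forall>n. a n = r n 0))"

definition riordan :: "real fps \<Rightarrow> real fps \<Rightarrow> nat \<Rightarrow> nat \<Rightarrow> real" where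
  "riordan g f n k = fps_nth (fps_X ^ k * f ^ k * g) n"

definition is_riordan_array :: "(nat \<Rightarrow> nat \<Rightarrow> real) \<Rightarrow> bool" where
  "is_riordan_array A \<longleftrightarrow> (\<exists>g f. A = riordan g f)"

text \<open>
  Laurent polynomials are taken inside the ring of formal Laurent series.
\<close>

definition trinomial_triangle :: "real \<Rightarrow> real \<Rightarrow> nat \<Rightarrow> nat \<Rightarrow> real" where
  "trinomial_triangle b c n k = fls_nth ((fls_X + fls_const b + fls_const c / fls_X) ^ n) (int k)"

definition central_trinomial :: "real \<Rightarrow> real \<Rightarrow> nat \<Rightarrow> real" where
  "central_trinomial b c n = trinomial_triangle b c n 0"

definition motzkin :: "real \<Rightarrow> real \<Rightarrow> nat \<Rightarrow> real" where
  "motzkin b c n =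
     (\<Sum>k = 0..n div 2. fact n / (fact k * fact (k + 1) * fact (n - 2 * k)) * b ^ (n - 2 * k) * c ^ k)"

definition central_trinomial_gf :: "real \<Rightarrow> real \<Rightarrow> real fps" where
  "central_trinomial_gf b c = Abs_fps (central_trinomial b c)"

definition motzkin_gf :: "real \<Rightarrow> real \<Rightarrow> real fps" where
  "motzkin_gf b c = Abs_fps (motzkin b c)"

lemma fls_nth_monomial_product:
  "fls_nth (fls_X ^ i * (fls_const c / fls_X) ^ m) 0 = (if i = m then c ^ m else (0::real))"
proof -
  have 1: "fls_const c / fls_X = fls_const c * (fls_X_inv :: real fls)"
    by (simp add: field_class.field_divide_inverse fls_inverse_X)
  have 2: "fls_X ^ i * (fls_const c / fls_X) ^ m
        = fls_const (c ^ m) * (fls_X ^ i * (fls_X_inv :: real fls) ^ m)"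
    unfolding 1 by (simp only: power_mult_distrib fls_const_power mult_ac)
  show ?thesis
    by (subst 2) (auto simp only: fls_mult_const_nth fls_X_power_times_conv_shift(1)
        fls_shift_nth fls_X_inv_power_nth split: if_splits)
qed

lemma central_trinomial_eq_sum:
  "central_trinomial b c n =
     (\<Sum>k = 0..n div 2. fact n / (fact k * fact k * fact (n - 2 * k)) * b ^ (n - 2 * k) * c ^ k)"
proof -
  define X :: "real fls" where "X = fls_X"
  define Y :: "real fls" where "Y = fls_const c / fls_X"
  have XY: "fls_nth ((X + Y) ^ j) 0 = (if even j then real (j choose (j div 2)) * c ^ (j div 2) else 0)" for j
  proof -
    have "fls_nth ((X + Y) ^ j) 0
        = (\<Sum>i\<le>j. real (j choose i) * fls_nth (X ^ i * Y ^ (j - i)) 0)"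
      by (simp add: binomial_ring fls_nth_sum mult.assoc fls_of_nat)
    also have "\<dots> = (\<Sum>i\<le>j. if i = j div 2 \<and> even j then real (j choose i) * c ^ (j - i) else 0)"
      unfolding X_def Y_def fls_nth_monomial_product
    proof (rule sum.cong)
      fix i assume "i \<in> {..j}"
      then have "i = j - i \<longleftrightarrow> i = j div 2 \<and> even j" by simp presburger
      then show "real (j choose i) * (if i = j - i then c ^ (j - i) else 0)
          = (if i = j div 2 \<and> even j then real (j choose i) * c ^ (j - i) else 0)"
        by simp
    qed simp
    also have "\<dots> = (if even j then real (j choose (j div 2)) * c ^ (j div 2) else 0)"
      by (auto elim!: evenE)
    finally show ?thesis .
  qed
  have "central_trinomial b c n = fls_nth (((X + Y) + fls_const b) ^ n) 0"
    by (simp add: central_trinomial_def trinomial_triangle_def X_def Y_def add_ac)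
  also have "\<dots> = (\<Sum>j\<le>n. real (n choose j) * b ^ (n - j) * fls_nth ((X + Y) ^ j) 0)"
  proof -
    have "of_nat (n choose j) * (X + Y) ^ j * fls_const b ^ (n - j)
        = fls_const (real (n choose j)) * (fls_const (b ^ (n - j)) * (X + Y) ^ j)" for j
      by (simp only: fls_of_nat fls_const_power mult_ac)
    then show ?thesis
      by (simp only: binomial_ring[of "X + Y"] fls_nth_sum fls_mult_const_nth mult.assoc)
  qed
  also have "\<dots> = (\<Sum>j\<in>(\<lambda>k. 2 * k) ` {0..n div 2}. real (n choose j) * b ^ (n - j) * fls_nth ((X + Y) ^ j) 0)"
    by (rule sum.mono_neutral_right) (auto simp: XY elim!: evenE)
  also have "\<dots> = (\<Sum>k = 0..n div 2. real (n choose (2 * k)) * b ^ (n - 2 * k) * (real ((2 * k) choose k) * c ^ k))"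
    by (subst sum.reindex) (auto simp: inj_on_def XY)
  also have "\<dots> = (\<Sum>k = 0..n div 2. fact n / (fact k * fact k * fact (n - 2 * k)) * b ^ (n - 2 * k) * c ^ k)"
    by (rule sum.cong) (auto simp: binomial_fact mult_ac)
  finally show ?thesis .
qed

end

theory Submission
  imports Defs
begin

text \<open>
  Write \<open>x\<close> for the indeterminate and let \<open>M\<close> be the power series solution of
  \<open>M = 1 + b x M + c x\<^sup>2 M\<^sup>2\<close>.  With \<open>T = 1 / (1 - b x - 2 c x\<^sup>2 M)\<close>, the Riordan array of
  \<open>(T, M)\<close> satisfies the same recurrence as the trinomial triangle, so the two arrays coincide, and
  column 0 identifies \<open>T\<close>.  The equation for \<open>M\<close> also gives \<open>M = T (1 - c x\<^sup>2 M\<^sup>2)\<close>, so the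
  \<open>n\<close>th coefficient of \<open>M\<close> is \<open>t n 0 - c * t n 2\<close>, where \<open>t\<close> is the trinomial triangle;
  by the binomial theorem this is the Motzkin number.
\<close>

definition trinomial_fls :: "real \<Rightarrow> real \<Rightarrow> real fls" where
  "trinomial_fls b c = fls_X + fls_const b + fls_const c / fls_X"

lemma trinomial_triangle_altdef:
  "trinomial_triangle b c n k = fls_nth (trinomial_fls b c ^ n) (int k)"
  by (simp add: trinomial_triangle_def trinomial_fls_def)

lemma fls_const_over_X: "fls_const (c :: real) / fls_X = fls_const c * fls_X_inv"
  by (simp add: field_class.field_divide_inverse fls_inverse_X)

text \<open>Here \<open>j\<close> ranges over all integers: the reflection of negative exponents to
  positive ones is proved from this recurrence.\<close>

lemma fls_nth_trinomial_power_Suc: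
  "fls_nth (trinomial_fls b c ^ Suc n) j =
     fls_nth (trinomial_fls b c ^ n) (j - 1) + b * fls_nth (trinomial_fls b c ^ n) j +
     c * fls_nth (trinomial_fls b c ^ n) (j + 1)"
proof -
  define P where "P = trinomial_fls b c ^ n"
  have "trinomial_fls b c ^ Suc n = fls_X * P + fls_const b * P + fls_const c * (fls_X_inv * P)"
    by (simp only: P_def power_Suc distrib_right mult.assoc
        trinomial_fls_def[of b c, unfolded fls_const_over_X])
  then show ?thesis
    by (simp add: fls_X_times_conv_shift fls_X_inv_times_conv_shift P_def)
qed

text \<open>For nonzero \<open>c\<close>, the substitution of \<open>c / x\<close> for
  \<open>x\<close> fixes \<open>x + b + c / x\<close>, which suggests the identity. The induction on
  \<open>n\<close> also covers \<open>c = 0\<close>.\<close>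

lemma fls_nth_trinomial_power_uminus:
  "fls_nth (trinomial_fls b c ^ n) (- int k) = c ^ k * fls_nth (trinomial_fls b c ^ n) (int k)"
proof (induction n arbitrary: k)
  case 0
  show ?case by (cases k) auto
next
  case (Suc n)
  show ?case
  proof (cases k)
    case (Suc l)
    have "- int k - 1 = - int (Suc k)" "- int k + 1 = - int l" "int k - 1 = int l"
      "int k + 1 = int (Suc k)"
      using Suc by simp_all
    then show ?thesis
      unfolding fls_nth_trinomial_power_Suc by (simp only: Suc.IH) (simp add: Suc algebra_simps)
  qed simp
qed

lemma trinomial_triangle_0: "trinomial_triangle b c 0 k = (if k = 0 then 1 else 0)"
  by (simp add: trinomial_triangle_def)

text \<open>In column 0 the neighbour in column -1 equals \<open>c\<close> times the entry in column
  1, by reflection. This doubles the coefficient \<open>c\<close> to \<open>2 * c\<close>.\<close>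

lemma trinomial_triangle_Suc:
  "trinomial_triangle b c (Suc n) k =
     (if k = 0 then 0 else trinomial_triangle b c n (k - 1)) + b * trinomial_triangle b c n k +
     (if k = 0 then 2 * c else c) * trinomial_triangle b c n (Suc k)"
proof (cases k)
  case 0
  have "fls_nth (trinomial_fls b c ^ n) (- 1) = c * fls_nth (trinomial_fls b c ^ n) 1"
    using fls_nth_trinomial_power_uminus[of b c n 1] by simp
  then show ?thesis
    unfolding trinomial_triangle_altdef fls_nth_trinomial_power_Suc by (simp add: 0)
next
  case (Suc l)
  then have "int k - 1 = int l" by simp
  with Suc show ?thesis
    unfolding trinomial_triangle_altdef fls_nth_trinomial_power_Suc by (simp add: add.commute)
qed

lemma trinomial_triangle_eq_0: "n < k \<Longrightarrow> trinomial_triangle b c n k = 0"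
  by (induction n arbitrary: k) (auto simp: trinomial_triangle_0 trinomial_triangle_Suc)

text \<open>There are no sign conditions on \<open>b\<close> and \<open>c\<close>, so that the
  result serves the Riordan part for all real parameters.\<close>

lemma trinomial_triangle_unique:
  assumes "\<And>k. r 0 k = (if k = 0 then 1 else 0)"
    and "\<And>n k. r (Suc n) k = (if k = 0 then 0 else r n (k - 1)) + b * r n k +
           (if k = 0 then 2 * c else c) * r n (Suc k)"
  shows "r = trinomial_triangle b c"
proof -
  have "r n k = trinomial_triangle b c n k" for n k
    by (induction n arbitrary: k) (simp_all add: assms trinomial_triangle_0 trinomial_triangle_Suc)
  then show ?thesis by blast
qed

text \<open>Let \<open>m\<close> of the \<open>n\<close> factors contribute \<open>c / x\<close>;
  the other \<open>n - m\<close> factors \<open>x + b\<close> must then contribute \<open>x\<close>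
  exactly \<open>m + k\<close> times. Where the subtraction in the exponent of \<open>b\<close>
  truncates, the second binomial coefficient is 0.\<close>

lemma trinomial_triangle_eq_sum:
  "trinomial_triangle b c n k =
     (\<Sum>m\<le>n. real (n choose m) * real ((n - m) choose (m + k)) * b ^ (n - 2 * m - k) * c ^ m)"
proof -
  have X: "fls_nth ((fls_X + fls_const b) ^ p) (int i) = real (p choose i) * b ^ (p - i)" for p i
  proof -
    have "fls_X + fls_const b = fps_to_fls (fps_of_poly [:b, 1:])"
      by (rule fls_eqI) (auto simp: fps_of_poly_def coeff_pCons nat_eq_iff split: nat.splits)
    then have "fls_nth ((fls_X + fls_const b) ^ p) (int i) = coeff ([:b, 1:] ^ p) i"
      by (simp flip: fps_to_fls_power fps_of_poly_power)
    also have "\<dots> = real (p choose i) * b ^ (p - i)"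
      by (cases "i \<le> p") (simp_all add: coeff_linear_poly_power coeff_eq_0 degree_linear_power)
    finally show ?thesis .
  qed
  have "trinomial_triangle b c n k =
      fls_nth ((fls_const c * fls_X_inv + (fls_X + fls_const b)) ^ n) (int k)"
    by (simp only: trinomial_triangle_def fls_const_over_X add_ac)
  also have "\<dots> = (\<Sum>m\<le>n. fls_nth (fls_const (real (n choose m)) * (fls_const (c ^ m) *
      (fls_X_inv ^ m * (fls_X + fls_const b) ^ (n - m)))) (int k))"
    by (simp only: binomial_ring fls_nth_sum fls_of_nat power_mult_distrib fls_const_power mult.assoc)
  also have "\<dots> = (\<Sum>m\<le>n. real (n choose m) * (c ^ m *
      fls_nth ((fls_X + fls_const b) ^ (n - m)) (int (m + k))))"
    by (simp add: fls_X_inv_power_times_conv_shift add_ac)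
  also have "\<dots> = (\<Sum>m\<le>n. real (n choose m) * real ((n - m) choose (m + k)) *
      b ^ (n - 2 * m - k) * c ^ m)"
    unfolding X by (simp add: mult_ac mult_2_right diff_diff_left add_ac)
  finally show ?thesis .
qed

text \<open>The sums agree term by term, because 1/(m! (m+1)!) = 1/(m! m!) - 1/((m-1)! (m+1)!) for
  positive \<open>m\<close>.\<close>

lemma motzkin_eq_trinomial:
  "motzkin b c n = trinomial_triangle b c n 0 - c * trinomial_triangle b c n 2"
proof -
  define h where "h m = real (n choose m) * real ((n - m) choose (m + 2)) *
    b ^ (n - 2 * m - 2) * c ^ Suc m" for m
  \<comment> \<open>Shifting the index by one makes \<open>g m\<close> the term with
    \<open>c ^ m\<close>, aligned with the Motzkin and central trinomial sums.\<close>
  define g where "g m = (case m of 0 \<Rightarrow> 0 | Suc l \<Rightarrow> h l)" for m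
  have "c * trinomial_triangle b c n 2 = (\<Sum>m\<le>n. h m)"
    by (simp add: trinomial_triangle_eq_sum h_def sum_distrib_left mult_ac)
  also have "\<dots> = (\<Sum>m\<le>Suc n. g m)"
    by (subst sum.atMost_Suc_shift) (simp add: g_def)
  also have "\<dots> = (\<Sum>m = 0..n div 2. g m)"
    by (rule sum.mono_neutral_right) (auto simp: g_def h_def split: nat.splits)
  finally have 2: "c * trinomial_triangle b c n 2 = (\<Sum>m = 0..n div 2. g m)" .
  have "fact n / (fact m * fact (m + 1) * fact (n - 2 * m)) * b ^ (n - 2 * m) * c ^ m =
      fact n / (fact m * fact m * fact (n - 2 * m)) * b ^ (n - 2 * m) * c ^ m - g m"
    if m: "m \<le> n div 2" for m
  proof (cases m)
    case 0
    then show ?thesis by (simp add: g_def)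
  next
    case (Suc l)
    have "g m = fact n / (fact l * fact (Suc m) * fact (n - 2 * m)) * b ^ (n - 2 * m) * c ^ m"
      using m Suc by (simp add: g_def h_def binomial_fact mult_2)
    moreover have "1 / (fact m * fact (m + 1)) =
        1 / (fact m * fact m) - 1 / (fact l * fact (Suc m) :: real)"
    proof -
      \<comment> \<open>With \<open>x = m\<close> and \<open>y = fact l\<close>, where
        \<open>m = Suc l\<close>, the products are the factorials of \<open>m\<close> and
        \<open>m + 1\<close>.\<close>
      have "1 / ((x * y) * ((x + 1) * (x * y))) =
          1 / ((x * y) * (x * y)) - 1 / (y * ((x + 1) * (x * y)))"
        if "x > 0" "y > 0" for x y :: real
      proof -
        have "x + 1 \<noteq> 0" using that by simp
        with that show ?thesis by (simp add: divide_simps)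
      qed
      from this[of "real m" "fact l"] show ?thesis
        using Suc by (simp add: add_ac)
    qed
    then have "A * (1 / (fact m * fact (m + 1))) =
        A * (1 / (fact m * fact m)) - A * (1 / (fact l * fact (Suc m)))" for A :: real
      by (simp only: right_diff_distrib)
    from this[of "fact n / fact (n - 2 * m) * b ^ (n - 2 * m) * c ^ m"]
    have "fact n / (fact m * fact (m + 1) * fact (n - 2 * m)) * b ^ (n - 2 * m) * c ^ m =
        fact n / (fact m * fact m * fact (n - 2 * m)) * b ^ (n - 2 * m) * c ^ m -
        fact n / (fact l * fact (Suc m) * fact (n - 2 * m)) * b ^ (n - 2 * m) * c ^ m"
      by (simp only: divide_inverse inverse_mult_distrib mult_ac mult_1)
    ultimately show ?thesis
      by simp
  qed
  then have "motzkin b c n = central_trinomial b c n - c * trinomial_triangle b c n 2"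
    by (simp add: motzkin_def central_trinomial_eq_sum 2 flip: sum_subtractf)
  then show ?thesis by (simp add: central_trinomial_def)
qed

text \<open>
  The series \<open>x M\<close> is the compositional inverse of \<open>x / (1 + b x + c x\<^sup>2)\<close>.
\<close>

lemma motzkin_equation_solvable:
  obtains M :: "real fps" where
    "M = 1 + fps_const b * fps_X * M + fps_const c * fps_X ^ 2 * M ^ 2"
proof -
  define q :: "real fps" where "q = 1 + fps_const b * fps_X + fps_const c * fps_X ^ 2"
  define f where "f = fps_X * inverse q"
  define g where "g = fps_inv f"
  have q0: "fps_nth q 0 = 1" by (simp add: q_def)
  have f: "fps_nth f 0 = 0" "fps_nth f 1 \<noteq> 0" by (simp_all add: f_def q0)
  have g0: "fps_nth g 0 = 0" by (simp add: g_def fps_inv_def)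
  have "f * q = fps_X"
    using q0 by (simp add: f_def mult.assoc inverse_mult_eq_1)
  \<comment> \<open>Composing \<open>f * q = fps_X\<close> with \<open>g\<close> leads to
    \<open>g = fps_X * q(g)\<close>.\<close>
  then have "(f oo g) * (q oo g) = g"
    using g0 by (simp flip: fps_compose_mult_distrib)
  moreover have "f oo g = fps_X"
    unfolding g_def using f by (rule fps_inv_right)
  moreover have "fps_X ^ 2 oo g = g ^ 2"
    using g0 by (simp add: power2_eq_square fps_compose_mult_distrib)
  then have qg: "q oo g = 1 + fps_const b * g + fps_const c * g ^ 2"
    using g0 by (simp add: q_def fps_compose_add_distrib fps_compose_mult_distrib)
  ultimately have *: "fps_X * (1 + fps_const b * g + fps_const c * g ^ 2) = g" by simp
  \<comment> \<open>As \<open>g\<close> has no constant term, it is divisible by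
    \<open>fps_X\<close>; the quotient \<open>fps_shift 1 g\<close> is the solution sought.\<close>
  have g: "g = fps_X * fps_shift 1 g"
    using g0 by (intro fps_ext) simp
  have "fps_X * fps_shift 1 g =
      fps_X * (1 + fps_const b * fps_X * fps_shift 1 g + fps_const c * fps_X ^ 2 * fps_shift 1 g ^ 2)"
    using * g by (metis (no_types, lifting) mult.assoc power_mult_distrib)
  then show thesis using that by simp
qed

theorem theorem3p5:
  fixes b c :: real
  shows "(b \<ge> 0 \<and> c \<ge> 0 \<longrightarrow>
            is_recursive_matrix (\<lambda>k. b) (\<lambda>k. if k = 1 then 2 * c else c) (trinomial_triangle b c) \<and>
            is_catalan_like (\<lambda>k. b) (\<lambda>k. if k = 1 then 2 * c else c) (central_trinomial b c)) \<and>
         is_riordan_array (trinomial_triangle b c) \<and>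
         trinomial_triangle b c = riordan (central_trinomial_gf b c) (motzkin_gf b c)"
proof -
  have rec: "is_recursive_matrix (\<lambda>k. b) (\<lambda>k. if k = 1 then 2 * c else c) (trinomial_triangle b c)"
    if "b \<ge> 0" "c \<ge> 0"
    using that by (auto simp: is_recursive_matrix_def trinomial_triangle_0 trinomial_triangle_Suc
        trinomial_triangle_eq_0)
  then have cat: "is_catalan_like (\<lambda>k. b) (\<lambda>k. if k = 1 then 2 * c else c) (central_trinomial b c)"
    if "b \<ge> 0" "c \<ge> 0"
    using that unfolding is_catalan_like_def central_trinomial_def by blast
  obtain M :: "real fps" where
    M: "M = 1 + fps_const b * fps_X * M + fps_const c * fps_X ^ 2 * M ^ 2"
    by (rule motzkin_equation_solvable)
  define S where "S = 1 - fps_const b * fps_X - 2 * fps_const c * fps_X ^ 2 * M"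
  define T where "T = inverse S"
  have S0: "fps_nth S 0 = 1" by (simp add: S_def numeral_fps_const)
  then have ST: "S * T = 1" by (simp add: T_def inverse_mult_eq_1')
  define D where "D k = fps_X ^ k * M ^ k * T" for k
  \<comment> \<open>This is \<open>S * T = 1\<close> solved for \<open>T\<close>; the summand 1 is
    the entry in row 0.\<close>
  have D0: "D 0 = 1 + fps_X * (fps_const b * D 0 + fps_const (2 * c) * D 1)"
  proof -
    have "fps_const (2 * c) = 2 * fps_const c" by (simp add: numeral_fps_const)
    then have "1 + fps_X * (fps_const b * D 0 + fps_const (2 * c) * D 1) =
        S * T + fps_X * (fps_const b * T + 2 * fps_const c * (fps_X * M * T))"
      by (simp add: ST D_def)
    also have "\<dots> = D 0"
      by (simp add: S_def D_def algebra_simps power2_eq_square)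
    finally show ?thesis ..
  qed
  \<comment> \<open>One factor \<open>M\<close> of \<open>D (Suc k)\<close> is replaced by the
    right-hand side of its equation; the three summands yield the three neighbouring
    columns.\<close>
  have DSuc: "D (Suc k) = fps_X * (D k + fps_const b * D (Suc k) + fps_const c * D (Suc (Suc k)))" for k
  proof -
    have "D (Suc k) = fps_X ^ Suc k * M ^ k * T * M" by (simp add: D_def mult_ac)
    also have "\<dots> = fps_X ^ Suc k * M ^ k * T *
        (1 + fps_const b * fps_X * M + fps_const c * fps_X ^ 2 * M ^ 2)"
      by (rule arg_cong[OF M])
    also have "\<dots> = fps_X * (D k + fps_const b * D (Suc k) + fps_const c * D (Suc (Suc k)))"
      by (simp add: D_def algebra_simps power2_eq_square)
    finally show ?thesis .
  qed
  have tri: "riordan T M = trinomial_triangle b c"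
  proof (rule trinomial_triangle_unique)
    fix k
    show "riordan T M 0 k = (if k = 0 then 1 else 0)"
      using S0 by (cases k) (simp_all add: riordan_def T_def mult.assoc)
  next
    fix n k
    have R: "riordan T M n k = fps_nth (D k) n" for n k
      by (simp add: riordan_def D_def)
    show "riordan T M (Suc n) k = (if k = 0 then 0 else riordan T M n (k - 1)) +
        b * riordan T M n k + (if k = 0 then 2 * c else c) * riordan T M n (Suc k)"
    proof (cases k)
      case 0
      then show ?thesis unfolding R by (simp, subst D0) simp
    next
      case (Suc l)
      then show ?thesis unfolding R by (simp, subst DSuc) simp
    qed
  qed
  have col: "Abs_fps (\<lambda>n. trinomial_triangle b c n k) = D k" for k
    by (rule fps_ext) (simp add: tri[symmetric] riordan_def D_def)
  have "central_trinomial_gf b c = T"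
    using col[of 0] by (simp add: central_trinomial_gf_def central_trinomial_def[abs_def] D_def)
  moreover have "motzkin_gf b c = M"
  proof -
    have "motzkin_gf b c = D 0 - fps_const c * D 2"
      by (rule fps_ext) (simp add: motzkin_gf_def motzkin_eq_trinomial flip: col)
    also have "\<dots> = T * (1 - fps_const c * fps_X ^ 2 * M ^ 2)"
      by (simp add: D_def algebra_simps)
    \<comment> \<open>The equation for \<open>M\<close> gives S M = M - b x M - 2 c x^2 M^2 = 1 - c
      x^2 M^2.\<close>
    also have "\<dots> = S * T * M"
      using M unfolding S_def by algebra
    finally show ?thesis using ST by simp
  qed
  ultimately have "trinomial_triangle b c = riordan (central_trinomial_gf b c) (motzkin_gf b c)"
    using tri by simp
  with rec cat show ?thesis
    unfolding is_riordan_array_def by blast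
qed

end
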